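(* Let $F$ be a field, and let $a_1<\cdots<a_d$ be positive integers with $\gcd(a_1,\dots,a_d)=1$ that non-redundantly generate their numerical semigroup. Let $A=F[[t^{a_1},\dots,t^{a_d}]]\subset F[[t]]$, let $R=F[[x_1,\dots,x_d]]$, and let $P$ be the defining ideal of $A$ in $R$, so that $A\cong R/P$. Suppose that the sequence $\{a_i\}$ has an arithmetic subsequence of length $5$, whose terms are not necessarily consecutive in $\{a_i\}$. Then: \begin{enumerate} \item if $P^n=P^{(n)}$ for all positive integers $n\leq \operatorname{ht} P=d-1$, then $P^n=P^{(n)}$ for all positive integers $n$; \item if $P^2=P^{(2)}$, then $R/P$ is Gorenstein. \end{enumerate}
   Context: The defining ideal $P$ of $A$ is the kernel of the $F$-algebra homomorphism $F[[x_1,\dots,x_d]]\to F[[t]]$ sending $x_i\mapsto t^{a_i}$ for all $i$; its image is $A$. Positive integers $a_1,\dots,a_d$ non-redundantly generate their numerical semigroup if no $a_i$ is a non-negative integer linear combination of the others. For a prime ideal $P$ of a Noetherian ring $R$ and a positive integer $n$, the $n$-th symbolic power is $P^{(n)}=P^nR_P\cap R=\{x\in R \mid \exists\, s\in R\setminus P,\ sx\in P^n\}$. *)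

theory Defs
  imports
    "HOL-Algebra.Algebra"
    "HOL-Algebra.Algebraic_Closure_Type"
    "HOL-Computational_Algebra.Formal_Power_Series"
    "HOL-Library.Extended_Nat"
begin

text \<open>
  The ring \<open>F[[x\<^sub>1,\<dots>,x\<^sub>d]]\<close>: the variables are indexed by a finite type, exponent
  vectors are functions from it to the natural numbers, and \<open>\<le>\<close> and \<open>-\<close> on them are pointwise.
\<close>

typedef ('d, 'a) mfps = "UNIV :: (('d \<Rightarrow> nat) \<Rightarrow> 'a) set"
  morphisms mfps_nth Abs_mfps
  by simp

setup_lifting type_definition_mfps

lemma finite_atMost_exponents: "finite {..e :: 'd::finite \<Rightarrow> nat}"
proof (rule finite_subset)
  show "{..e} \<subseteq> PiE UNIV (\<lambda>i. {..e i})"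
    by (auto simp: le_fun_def PiE_def)
qed (auto intro: finite_PiE)

lemma mfps_mult_assoc_aux:
  fixes f g h :: "('d::finite \<Rightarrow> nat) \<Rightarrow> 'a::comm_ring_1"
  shows "(\<Sum>u\<in>{..e}. (\<Sum>v\<in>{..u}. f v * g (u - v)) * h (e - u)) =
         (\<Sum>v\<in>{..e}. f v * (\<Sum>w\<in>{..e - v}. g w * h (e - v - w)))"
proof -
  have "(\<Sum>u\<in>{..e}. (\<Sum>v\<in>{..u}. f v * g (u - v)) * h (e - u)) =
      (\<Sum>(u, v)\<in>(SIGMA u:{..e}. {..u}). f v * g (u - v) * h (e - u))"
    by (simp add: sum.Sigma finite_atMost_exponents sum_distrib_right)
  also have "\<dots> = (\<Sum>(v, w)\<in>(SIGMA v:{..e}. {..e - v}). f v * g w * h (e - v - w))"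
  proof (rule sum.reindex_bij_witness
      [where i = "\<lambda>(v, w). (\<lambda>i. v i + w i, v)" and j = "\<lambda>(u, v). (v, u - v)"], goal_cases)
    case (1 p)
    then show ?case by (auto simp: le_fun_def fun_eq_iff)
  next
    case (2 p)
    then show ?case by (auto simp: le_fun_def diff_le_mono intro: order_trans)
  next
    case (3 p)
    then show ?case by (auto simp: le_fun_def fun_eq_iff)
  next
    case (4 p)
    obtain v w where p: "p = (v, w)" by force
    have "v i + w i \<le> e i" for i
      using 4 unfolding p by (simp add: le_fun_def) (metis le_diff_conv2 add.commute)
    then show ?case by (simp add: p le_fun_def)
  next
    case (5 p)
    obtain u v where p: "p = (u, v)" by force
    have "e - v - (u - v) = e - u"
      using 5 unfolding p by (auto simp: le_fun_def fun_eq_iff)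
    then show ?case by (simp add: p)
  qed
  also have "\<dots> = (\<Sum>v\<in>{..e}. f v * (\<Sum>w\<in>{..e - v}. g w * h (e - v - w)))"
    by (simp add: sum.Sigma finite_atMost_exponents sum_distrib_left mult.assoc)
  finally show ?thesis .
qed

lemma mfps_mult_commute_aux:
  fixes f g :: "('d::finite \<Rightarrow> nat) \<Rightarrow> 'a::comm_ring_1"
  shows "(\<Sum>u\<in>{..e}. f u * g (e - u)) = (\<Sum>u\<in>{..e}. g u * f (e - u))"
proof -
  have "e - (e - u) = u" if "u \<le> e" for u
    using that by (auto simp: le_fun_def fun_eq_iff)
  then show ?thesis
    by (intro sum.reindex_bij_witness[where i = "\<lambda>u. e - u" and j = "\<lambda>u. e - u"])
      (auto simp: mult.commute, auto simp: le_fun_def)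
qed

lemma mfps_mult_one_aux:
  fixes f :: "('d::finite \<Rightarrow> nat) \<Rightarrow> 'a::comm_ring_1"
  shows "(\<Sum>u\<in>{..e}. (if u = (\<lambda>_. 0) then 1 else 0) * f (e - u)) = f e"
proof -
  have "(\<Sum>u\<in>{..e}. (if u = (\<lambda>_. 0) then 1 else 0) * f (e - u)) =
        (\<Sum>u\<in>{\<lambda>_. 0}. (if u = (\<lambda>_. 0) then 1 else 0) * f (e - u))"
    by (rule sum.mono_neutral_right) (auto simp: finite_atMost_exponents le_fun_def)
  also have "\<dots> = f e"
    by (simp add: fun_diff_def)
  finally show ?thesis .
qed

instantiation mfps :: (finite, comm_ring_1) comm_ring_1
begin

lift_definition zero_mfps :: "('a, 'b) mfps" is "\<lambda>_. 0" .

lift_definition one_mfps :: "('a, 'b) mfps" is "\<lambda>e. if e = (\<lambda>_. 0) then 1 else 0" .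

lift_definition plus_mfps :: "('a, 'b) mfps \<Rightarrow> ('a, 'b) mfps \<Rightarrow> ('a, 'b) mfps"
  is "\<lambda>f g e. f e + g e" .

lift_definition minus_mfps :: "('a, 'b) mfps \<Rightarrow> ('a, 'b) mfps \<Rightarrow> ('a, 'b) mfps"
  is "\<lambda>f g e. f e - g e" .

lift_definition uminus_mfps :: "('a, 'b) mfps \<Rightarrow> ('a, 'b) mfps"
  is "\<lambda>f e. - f e" .

lift_definition times_mfps :: "('a, 'b) mfps \<Rightarrow> ('a, 'b) mfps \<Rightarrow> ('a, 'b) mfps"
  is "\<lambda>f g e. \<Sum>u\<in>{..e}. f u * g (e - u)" .

instance
proof
  fix f g h :: "('a, 'b) mfps"
  show "f * g * h = f * (g * h)"
    by transfer (simp add: mfps_mult_assoc_aux)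
  show "f * g = g * f"
    by transfer (rule ext, rule mfps_mult_commute_aux)
  show "1 * f = f"
    by transfer (rule ext, rule mfps_mult_one_aux)
  show "(f + g) * h = f * h + g * h"
    by transfer (simp add: distrib_right sum.distrib)
  show "(0 :: ('a, 'b) mfps) \<noteq> 1"
    by transfer (auto simp: fun_eq_iff)
qed (transfer; auto simp: fun_eq_iff add.assoc add.commute)+

end

lift_definition mfps_const :: "'a \<Rightarrow> ('d, 'a::zero) mfps"
  is "\<lambda>c e. if e = (\<lambda>_. 0) then c else 0" .

lift_definition mfps_var :: "'d \<Rightarrow> ('d, 'a::zero_neq_one) mfps"
  is "\<lambda>i e. if e = (\<lambda>j. if j = i then 1 else 0) then 1 else 0" .

abbreviation mfps_ring :: "('d::finite, 'a::comm_ring_1) mfps ring" where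
  "mfps_ring \<equiv> ring_of_type_algebra"

abbreviation fps_ring :: "'a::comm_ring_1 fps ring" where
  "fps_ring \<equiv> ring_of_type_algebra"

text \<open>
  The substitution \<open>x\<^sub>i \<mapsto> t\<^bsup>a\<^sub>i\<^esup>\<close>: the monomial with exponent vector \<open>e\<close> goes to \<open>t\<close> to
  the power \<open>\<Sum>i. a i * e i\<close>. For positive \<open>a i\<close> every coefficient is a finite sum. The lemmas below
  show that it is the \<open>F\<close>-algebra homomorphism with the prescribed values on the variables.
\<close>

definition monomial_subst :: "('d::finite \<Rightarrow> nat) \<Rightarrow> ('d, 'a::comm_ring_1) mfps \<Rightarrow> 'a fps" where
  "monomial_subst a f = Abs_fps (\<lambda>n. \<Sum>e | (\<Sum>i\<in>UNIV. a i * e i) = n. mfps_nth f e)"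

lemma finite_weight_eq:
  fixes a :: "'d::finite \<Rightarrow> nat"
  assumes "\<And>i. a i > 0"
  shows "finite {e :: 'd \<Rightarrow> nat. (\<Sum>i\<in>UNIV. a i * e i) = n}"
proof (rule finite_subset)
  show "{e :: 'd \<Rightarrow> nat. (\<Sum>i\<in>UNIV. a i * e i) = n} \<subseteq> {..(\<lambda>_. n)}"
  proof (clarsimp simp: le_fun_def)
    fix e :: "'d \<Rightarrow> nat" and i
    have "e i \<le> a i * e i" using assms[of i] by simp
    also have "\<dots> \<le> (\<Sum>i\<in>UNIV. a i * e i)" by (rule member_le_sum) auto
    finally show "e i \<le> (\<Sum>i\<in>UNIV. a i * e i)" .
  qed
qed (rule finite_atMost_exponents)

lemma monomial_subst_const:
  assumes "\<And>i. a i > 0"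
  shows "monomial_subst a (mfps_const c) = fps_const c"
proof (rule fps_ext)
  fix n
  have "monomial_subst a (mfps_const c) $ n =
      (\<Sum>e | (\<Sum>i\<in>UNIV. a i * e i) = n. if e = (\<lambda>_. 0) then c else 0)"
    by (simp add: monomial_subst_def mfps_const.rep_eq)
  also have "\<dots> = fps_const c $ n"
    by (subst sum.delta) (auto simp: finite_weight_eq assms)
  finally show "monomial_subst a (mfps_const c) $ n = fps_const c $ n" .
qed

lemma monomial_subst_var:
  assumes "\<And>i. a i > 0"
  shows "monomial_subst a (mfps_var i) = fps_X ^ a i"
proof (rule fps_ext)
  fix n
  have "(\<Sum>j\<in>UNIV. a j * (if j = i then 1 else 0)) = a i"
    by (simp add: if_distrib cong: if_cong)
  moreover have "monomial_subst a (mfps_var i) $ n =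
      (\<Sum>e | (\<Sum>i\<in>UNIV. a i * e i) = n. if e = (\<lambda>j. if j = i then 1 else 0) then 1 else 0)"
    by (simp add: monomial_subst_def mfps_var.rep_eq)
  ultimately show "monomial_subst a (mfps_var i) $ n = (fps_X ^ a i) $ n"
    by (subst (asm) sum.delta) (auto simp: finite_weight_eq assms)
qed

lemma monomial_subst_add: "monomial_subst a (f + g) = monomial_subst a f + monomial_subst a g"
  by (rule fps_ext) (simp add: monomial_subst_def plus_mfps.rep_eq sum.distrib)

lemma monomial_subst_mult:
  fixes f g :: "('d::finite, 'a::comm_ring_1) mfps"
  assumes pos: "\<And>i. a i > 0"
  shows "monomial_subst a (f * g) = monomial_subst a f * monomial_subst a g"
proof (rule fps_ext)
  fix n
  define w where "w = (\<lambda>e :: 'd \<Rightarrow> nat. \<Sum>i\<in>UNIV. a i * e i)"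
  have fin: "finite {e. w e = k}" for k
    unfolding w_def by (rule finite_weight_eq) (rule pos)
  have w_add: "w (\<lambda>i. u i + v i) = w u + w v" for u v
    by (simp add: w_def distrib_left sum.distrib)
  have w_diff: "w u + w (e - u) = w e" if "u \<le> e" for u e
  proof -
    have "(\<lambda>i. u i + (e - u) i) = e" using that by (auto simp: le_fun_def)
    with w_add[of u "e - u"] show ?thesis by simp
  qed
  have w_le: "w u \<le> w e" and w_minus: "w (e - u) = w e - w u" if "\<forall>i. u i \<le> e i" for u e
    using w_diff[of u e] that by (auto simp: le_fun_def)
  have nth: "monomial_subst a F $ k = (\<Sum>e | w e = k. mfps_nth F e)"
    for F :: "('d, 'a) mfps" and k
    by (simp add: monomial_subst_def w_def)
  have "monomial_subst a (f * g) $ n =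
      (\<Sum>(e, u)\<in>(SIGMA e:{e. w e = n}. {..e}). mfps_nth f u * mfps_nth g (e - u))"
    by (simp add: nth times_mfps.rep_eq sum.Sigma fin finite_atMost_exponents)
  also have "\<dots> = (\<Sum>(k, u, v)\<in>(SIGMA k:{0..n}. {e. w e = k} \<times> {e. w e = n - k}).
      mfps_nth f u * mfps_nth g v)"
    by (rule sum.reindex_bij_witness
        [where i = "\<lambda>(k, u, v). (\<lambda>i. u i + v i, u)" and j = "\<lambda>(e, u). (w u, u, e - u)"])
      (auto simp: w_add w_le w_minus le_fun_def fun_eq_iff)
  also have "\<dots> = (monomial_subst a f * monomial_subst a g) $ n"
  proof -
    have "(monomial_subst a f * monomial_subst a g) $ n = (\<Sum>k=0..n.
        \<Sum>(u, v)\<in>{e. w e = k} \<times> {e. w e = n - k}. mfps_nth f u * mfps_nth g v)"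
      unfolding fps_mult_nth nth sum_product sum.cartesian_product ..
    also have "\<dots> = (\<Sum>(k, u, v)\<in>(SIGMA k:{0..n}. {e. w e = k} \<times> {e. w e = n - k}).
        mfps_nth f u * mfps_nth g v)"
      by (rule sum.Sigma) (simp_all add: fin)
    finally show ?thesis by simp
  qed
  finally show "monomial_subst a (f * g) $ n = (monomial_subst a f * monomial_subst a g) $ n" .
qed

lemma monomial_subst_ring_hom:
  assumes pos: "\<And>i. a i > 0"
  shows "monomial_subst a \<in> ring_hom (mfps_ring :: ('d::finite, 'a::comm_ring_1) mfps ring) fps_ring"
proof -
  have "(1 :: ('d, 'a) mfps) = mfps_const 1" by transfer simp
  then have "monomial_subst a (1 :: ('d, 'a) mfps) = 1"
    using monomial_subst_const[of a "1 :: 'a", OF pos] by simp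
  then show ?thesis
    by (intro ring_hom_memI)
      (simp_all add: ring_of_type_algebra_def monomial_subst_add monomial_subst_mult pos)
qed

definition defining_ideal :: "('d::finite \<Rightarrow> nat) \<Rightarrow> ('d, 'a::field) mfps set" where
  "defining_ideal a = a_kernel mfps_ring fps_ring (monomial_subst a)"

definition nonredundant :: "('d::finite \<Rightarrow> nat) \<Rightarrow> bool" where
  "nonredundant a \<longleftrightarrow> (\<forall>i. \<not> (\<exists>c :: 'd \<Rightarrow> nat. a i = (\<Sum>j\<in>UNIV - {i}. c j * a j)))"

definition has_arithmetic_subsequence :: "('d::linorder \<Rightarrow> nat) \<Rightarrow> nat \<Rightarrow> bool" where
  "has_arithmetic_subsequence a l \<longleftrightarrow>
     (\<exists>s :: nat \<Rightarrow> 'd. strict_mono_on {..<l} s \<and> (\<exists>b \<delta>. \<forall>k<l. a (s k) = b + k * \<delta>))"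

definition ideal_power :: "('a, 'm) ring_scheme \<Rightarrow> 'a set \<Rightarrow> nat \<Rightarrow> 'a set" where
  "ideal_power R I n = I [^]\<^bsub>ideals_set R\<^esub> n"

definition symbolic_power :: "('a, 'm) ring_scheme \<Rightarrow> 'a set \<Rightarrow> nat \<Rightarrow> 'a set" where
  "symbolic_power R P n =
     {x \<in> carrier R. \<exists>s \<in> carrier R - P. s \<otimes>\<^bsub>R\<^esub> x \<in> ideal_power R P n}"

definition height :: "('a, 'm) ring_scheme \<Rightarrow> 'a set \<Rightarrow> enat" where
  "height R P = (SUP n \<in> {n. \<exists>Q :: nat \<Rightarrow> 'a set.
     (\<forall>i\<le>n. primeideal (Q i) R) \<and> (\<forall>i<n. Q i \<subset> Q (Suc i)) \<and> Q n = P}. enat n)"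

definition module_homs ::
    "('a, 'm) ring_scheme \<Rightarrow> ('a, 'b) module \<Rightarrow> ('a, 'c) module \<Rightarrow> ('b \<Rightarrow> 'c) set" where
  "module_homs R M N = {f \<in> carrier M \<rightarrow> carrier N.
     (\<forall>x\<in>carrier M. \<forall>y\<in>carrier M. f (x \<oplus>\<^bsub>M\<^esub> y) = f x \<oplus>\<^bsub>N\<^esub> f y) \<and>
     (\<forall>r\<in>carrier R. \<forall>x\<in>carrier M. f (r \<odot>\<^bsub>M\<^esub> x) = r \<odot>\<^bsub>N\<^esub> f x)}"

definition regular_module :: "('a, 'm) ring_scheme \<Rightarrow> ('a, 'a) module" where
  "regular_module R = \<lparr>carrier = carrier R, monoid.mult = (\<otimes>\<^bsub>R\<^esub>), one = \<one>\<^bsub>R\<^esub>,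
     ring.zero = \<zero>\<^bsub>R\<^esub>, add = (\<oplus>\<^bsub>R\<^esub>), module.smult = (\<otimes>\<^bsub>R\<^esub>)\<rparr>"

text \<open>
  A definition cannot quantify over types, so the modules below live on the fixed type
  \<open>nat \<Rightarrow> 'a\<close>, where \<open>'a\<close> is the type of ring elements. This loses nothing for injectivity, because
  by Baer's criterion it suffices to extend homomorphisms from ideals, and these have copies on
  that type. Nor does it for injective resolutions of a Noetherian ring \<open>R\<close>: the terms of its
  minimal injective resolution have cardinality at most that of \<open>R\<close>, or are countable.
\<close>

definition injective_module :: "('a, 'm) ring_scheme \<Rightarrow> ('a, nat \<Rightarrow> 'a) module \<Rightarrow> bool" where
  "injective_module R I \<longleftrightarrow> module R I \<and>
     (\<forall>(M :: ('a, nat \<Rightarrow> 'a) module) (N :: ('a, nat \<Rightarrow> 'a) module) f g.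
        module R M \<longrightarrow> module R N \<longrightarrow> f \<in> module_homs R M N \<longrightarrow> inj_on f (carrier M) \<longrightarrow>
        g \<in> module_homs R M I \<longrightarrow>
        (\<exists>h \<in> module_homs R N I. \<forall>x\<in>carrier M. h (f x) = g x))"

text \<open>
  An exact sequence \<open>0 \<rightarrow> M \<rightarrow> E\<^sub>0 \<rightarrow> E\<^sub>1 \<rightarrow> \<dots>\<close> with injective terms, zero beyond \<open>E\<^sub>n\<close>.
\<close>

definition injective_dimension_le ::
    "('a, 'm) ring_scheme \<Rightarrow> ('a, 'b) module \<Rightarrow> nat \<Rightarrow> bool" where
  "injective_dimension_le R M n \<longleftrightarrow>
     (\<exists>(E :: nat \<Rightarrow> ('a, nat \<Rightarrow> 'a) module) \<iota> \<delta>.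
        (\<forall>i. injective_module R (E i)) \<and>
        \<iota> \<in> module_homs R M (E 0) \<and> inj_on \<iota> (carrier M) \<and>
        (\<forall>i. \<delta> i \<in> module_homs R (E i) (E (Suc i))) \<and>
        \<iota> ` carrier M = a_kernel (E 0) (E 1) (\<delta> 0) \<and>
        (\<forall>i. \<delta> i ` carrier (E i) = a_kernel (E (Suc i)) (E (Suc (Suc i))) (\<delta> (Suc i))) \<and>
        (\<forall>i>n. carrier (E i) = {\<zero>\<^bsub>E i\<^esub>}))"

definition gorenstein_local_ring :: "('a, 'm) ring_scheme \<Rightarrow> bool" where
  "gorenstein_local_ring R \<longleftrightarrow> cring R \<and> noetherian_ring R \<and> (\<exists>!M. maximalideal M R) \<and>
     (\<exists>n. injective_dimension_le R (regular_module R) n)"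

end

theory Submission
  imports Defs
begin

text \<open>
  If the entries \<open>y\<^sub>0,\<dots>,y\<^sub>4\<close> are the variables whose exponents are in arithmetic progression, then
  the \<open>2 \<times> 2\<close> minors of the Hankel matrix \<open>(y\<^bsub>i+j\<^esub>)\<close> lie in \<open>P\<close>. The minors of the adjugate are the
  entries times the determinant \<open>\<Delta>\<close>, so that \<open>y\<^sub>4 \<Delta> \<in> P\<^sup>2\<close> and \<open>\<Delta> \<in> P\<^bsup>(2)\<^esup>\<close>. Nonredundancy means
  that \<open>P\<close> contains no series of order one, so every element of \<open>P\<^sup>2\<close> has order at least four,
  whereas \<open>\<Delta>\<close> is a nonzero cubic form. Hence \<open>P\<^sup>2 \<noteq> P\<^bsup>(2)\<^esup>\<close>, which refutes the hypothesis of the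
  second claim, and that of the first one because the height of \<open>P\<close> is at least two: freeing one
  or two variables in the substitution \<open>x\<^sub>i \<mapsto> t\<^bsup>a\<^sub>i\<^esup>\<close> gives smaller kernels, which are prime.
\<close>

section \<open>Substitution of monomials\<close>

lemma ring_of_type_algebra_sel [simp]:
  "carrier (ring_of_type_algebra :: 'a::comm_ring_1 ring) = UNIV"
  "x \<otimes>\<^bsub>ring_of_type_algebra\<^esub> y = (x * y :: 'a)"
  "x \<oplus>\<^bsub>ring_of_type_algebra\<^esub> y = (x + y :: 'a)"
  "\<zero>\<^bsub>ring_of_type_algebra\<^esub> = (0 :: 'a)"
  "\<one>\<^bsub>ring_of_type_algebra\<^esub> = (1 :: 'a)"
  by (simp_all add: ring_of_type_algebra_def)

lemma kernel_ring_of_type_algebra: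
  fixes h :: "'a::comm_ring_1 \<Rightarrow> 'b::comm_ring_1"
  shows "a_kernel ring_of_type_algebra ring_of_type_algebra h = {x. h x = 0}"
  by (simp add: a_kernel_def')

lemma primeideal_kernel:
  fixes h :: "'a::comm_ring_1 \<Rightarrow> 'b::idom"
  assumes "h \<in> ring_hom ring_of_type_algebra ring_of_type_algebra"
  shows "primeideal {x. h x = 0} ring_of_type_algebra"
proof (rule primeidealI)
  interpret ring_hom_ring "ring_of_type_algebra :: 'a ring" "ring_of_type_algebra :: 'b ring" h
    using assms by (intro ring_hom_ringI2 ring_from_type_algebra)
  show "ideal {x. h x = 0} ring_of_type_algebra"
    using kernel_is_ideal by (simp add: kernel_ring_of_type_algebra)
  have "1 \<notin> {x. h x = 0}"
    using hom_one by simp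
  then show "carrier ring_of_type_algebra \<noteq> {x. h x = 0}"
    by (metis UNIV_I ring_of_type_algebra_sel(1))
  show "a \<in> {x. h x = 0} \<or> b \<in> {x. h x = 0}"
    if "a \<otimes>\<^bsub>ring_of_type_algebra\<^esub> b \<in> {x. h x = 0}" for a b
    using that hom_mult[of a b] by simp
qed (rule cring_from_type_algebra)

lemma one_mfps_eq_const: "(1 :: ('d::finite, 'a::comm_ring_1) mfps) = mfps_const 1"
  by transfer simp

lemma monomial_subst_one:
  fixes a :: "'d::finite \<Rightarrow> nat"
  assumes "\<And>i. a i > 0"
  shows "monomial_subst a (1 :: ('d, 'a::comm_ring_1) mfps) = 1"
  using monomial_subst_const[of a "1 :: 'a", OF assms] by (simp add: one_mfps_eq_const)

lemma monomial_subst_diff: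
  "monomial_subst a (f - g) = monomial_subst a f - monomial_subst a g"
  by (rule fps_ext) (simp add: monomial_subst_def minus_mfps.rep_eq sum_subtractf)

lemma monomial_subst_power:
  fixes a :: "'d::finite \<Rightarrow> nat"
  assumes "\<And>i. a i > 0"
  shows "monomial_subst a (f ^ n) = monomial_subst a f ^ n"
  by (induction n) (simp_all add: monomial_subst_one monomial_subst_mult assms)

text \<open>The homomorphism \<open>x\<^sub>i \<mapsto> s\<^bsup>c\<^sub>i\<^esup> x\<^sub>i\<close>, where \<open>s\<close> is a new variable in the coefficients.\<close>

lift_definition mfps_twist ::
    "('d::finite \<Rightarrow> nat) \<Rightarrow> ('d, 'a::comm_ring_1) mfps \<Rightarrow> ('d, 'a fps) mfps"
  is "\<lambda>c f e. fps_const (f e) * fps_X ^ (\<Sum>i\<in>UNIV. c i * e i)" .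

lemma mfps_twist_add: "mfps_twist c (f + g) = mfps_twist c f + mfps_twist c g"
  by transfer (simp add: fun_eq_iff distrib_right flip: fps_const_add)

lemma mfps_twist_diff: "mfps_twist c (f - g) = mfps_twist c f - mfps_twist c g"
  by transfer (simp add: fun_eq_iff left_diff_distrib flip: fps_const_sub)

lemma fps_const_sum: "fps_const (sum f A) = (\<Sum>x\<in>A. fps_const (f x))"
  by (rule fps_ext) (simp add: fps_sum_nth)

lemma mfps_twist_mult:
  fixes f g :: "('d::finite, 'a::comm_ring_1) mfps"
  shows "mfps_twist c (f * g) = mfps_twist c f * mfps_twist c g"
proof (transfer, rule ext)
  fix c :: "'d \<Rightarrow> nat" and f g :: "('d \<Rightarrow> nat) \<Rightarrow> 'a" and e
  have "(\<Sum>i\<in>UNIV. c i * e i) = (\<Sum>i\<in>UNIV. c i * u i) + (\<Sum>i\<in>UNIV. c i * (e - u) i)"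
    if "u \<le> e" for u
    using that by (simp add: le_fun_def flip: sum.distrib distrib_left)
  then show "fps_const (\<Sum>u\<in>{..e}. f u * g (e - u)) * fps_X ^ (\<Sum>i\<in>UNIV. c i * e i) =
      (\<Sum>u\<in>{..e}. fps_const (f u) * fps_X ^ (\<Sum>i\<in>UNIV. c i * u i) *
        (fps_const (g (e - u)) * fps_X ^ (\<Sum>i\<in>UNIV. c i * (e - u) i)))"
    unfolding fps_const_sum sum_distrib_right
    by (intro sum.cong refl) (simp add: power_add mult_ac flip: fps_const_mult)
qed

lemma mfps_twist_one: "mfps_twist c 1 = 1"
  by transfer (auto simp: fun_eq_iff)

lemma mfps_twist_power: "mfps_twist c (f ^ n) = mfps_twist c f ^ n"
  by (induction n) (simp_all add: mfps_twist_one mfps_twist_mult)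

lemma mfps_nth_const_mult:
  fixes g :: "('d::finite, 'a::comm_ring_1) mfps"
  shows "mfps_nth (mfps_const b * g) e = b * mfps_nth g e"
proof -
  have "mfps_nth (mfps_const b * g) e =
      (\<Sum>u\<in>{..e}. if u = (\<lambda>_. 0) then b * mfps_nth g (e - u) else 0)"
    unfolding times_mfps.rep_eq mfps_const.rep_eq by (intro sum.cong) auto
  also have "\<dots> = b * mfps_nth g e"
    by (subst sum.delta) (auto simp: finite_atMost_exponents le_fun_def fun_diff_def)
  finally show ?thesis .
qed

lemma mfps_twist_var: "mfps_twist c (mfps_var i) = mfps_const (fps_X ^ c i) * mfps_var i"
  by (rule mfps_nth_inject[THEN iffD1], rule ext)
    (auto simp: mfps_nth_const_mult mfps_twist.rep_eq mfps_var.rep_eq if_distrib cong: if_cong)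

lemma mfps_twist_var_eq: "c i = 0 \<Longrightarrow> mfps_twist c (mfps_var i) = mfps_var i"
  by (simp add: mfps_twist_var flip: one_mfps_eq_const)

lemma mfps_twist_ring_hom: "mfps_twist c \<in> ring_hom ring_of_type_algebra ring_of_type_algebra"
  by (intro ring_hom_memI) (simp_all add: mfps_twist_add mfps_twist_mult mfps_twist_one)

lemma monomial_subst_twist_var:
  fixes a c :: "'d::finite \<Rightarrow> nat"
  assumes "\<And>i. a i > 0"
  shows "monomial_subst a (mfps_twist c (mfps_var i) :: ('d, 'a::comm_ring_1 fps) mfps) =
    fps_const (fps_X ^ c i) * fps_X ^ a i"
  by (simp add: mfps_twist_var monomial_subst_mult monomial_subst_const monomial_subst_var assms)

text \<open>Setting \<open>s = 1\<close> undoes the twist.\<close>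

lemma monomial_subst_twist_eq_0D:
  fixes a c :: "'d::finite \<Rightarrow> nat" and f :: "('d, 'a::comm_ring_1) mfps"
  assumes pos: "\<And>i. a i > 0" and 0: "monomial_subst a (mfps_twist c f) = 0"
  shows "monomial_subst a f = 0"
proof (rule fps_ext)
  fix n
  define E where "E = {e :: 'd \<Rightarrow> nat. (\<Sum>i\<in>UNIV. a i * e i) = n}"
  define w where "w = (\<lambda>e :: 'd \<Rightarrow> nat. \<Sum>i\<in>UNIV. c i * e i)"
  have E: "finite E"
    unfolding E_def by (rule finite_weight_eq) (rule pos)
  \<comment> \<open>This sum is the coefficient of t^n s^k in the twisted image, where s is the new
    variable.\<close>
  have "(\<Sum>e\<in>{e\<in>E. w e = k}. mfps_nth f e) = 0" for k
  proof -
    have "0 = monomial_subst a (mfps_twist c f) $ n $ k"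
      by (simp add: 0)
    also have "\<dots> = (\<Sum>e\<in>E. if w e = k then mfps_nth f e else 0)"
      by (auto simp: monomial_subst_def mfps_twist.rep_eq fps_sum_nth E_def w_def fps_X_power_iff
          intro!: sum.cong)
    finally show ?thesis
      by (simp add: sum.inter_filter E)
  qed
  \<comment> \<open>Adding up over all powers of s is the evaluation at s = 1; only finitely many
    weights occur on \<open>E\<close>.\<close>
  then have "(\<Sum>e\<in>E. mfps_nth f e) = 0"
    using sum.group[OF E finite_imageI[OF E] subset_refl, where g = w and h = "mfps_nth f"] by simp
  then show "monomial_subst a f $ n = 0 $ n"
    by (simp add: monomial_subst_def E_def)
qed

section \<open>The height of the defining ideal\<close>

lemma monomial_subst_binomial:
  fixes a :: "'d::finite \<Rightarrow> nat"
  assumes "\<And>i. a i > 0"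
  shows "monomial_subst a (mfps_var i ^ a j - mfps_var j ^ a i :: ('d, 'a::comm_ring_1) mfps) = 0"
  by (simp add: monomial_subst_diff monomial_subst_power monomial_subst_var assms mult.commute
      flip: power_mult)

text \<open>Only x_i picks up a factor s, so the two terms, both t^(a_i a_j) without the twist, no
  longer cancel: the image is (s^(a_j) - 1) t^(a_i a_j).\<close>

lemma monomial_subst_twist_binomial:
  fixes a c :: "'d::finite \<Rightarrow> nat"
  assumes pos: "\<And>i. a i > 0" and c: "c i = 1" "c j = 0"
  shows "monomial_subst a (mfps_twist c (mfps_var i ^ a j - mfps_var j ^ a i
    :: ('d, 'a::comm_ring_1) mfps)) \<noteq> 0" (is "?L \<noteq> 0")
proof -
  have "?L = fps_const (fps_X ^ a j - 1) * fps_X ^ (a i * a j)"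
    by (simp add: mfps_twist_diff mfps_twist_power monomial_subst_diff monomial_subst_power
        monomial_subst_twist_var pos c power_mult_distrib left_diff_distrib mult.commute
        flip: power_mult fps_const_sub)
  then have "?L $ (a i * a j) $ 0 = -1"
    using pos[of j] by (simp add: fps_X_power_iff)
  then show ?thesis
    by auto
qed

lemma height_defining_ideal_ge_2:
  fixes a :: "'d::finite \<Rightarrow> nat" and i j k :: 'd
  assumes pos: "\<And>i. a i > 0" and distinct: "distinct [i, j, k]"
  shows "enat 2 \<le> height mfps_ring (defining_ideal a :: ('d, 'a::field) mfps set)"
proof -
  \<comment> \<open>Twisting with \<open>c l\<close> frees the single variable x_l. The second twist
    acts over coefficients in \<open>'a fps\<close>, so its new variable is independent of the first
    one.\<close>
  define c where "c = (\<lambda>l m :: 'd. if m = l then 1 else 0 :: nat)"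
  have c: "c i i = 1" "c i j = 0" "c j j = 1" "c j k = 0" "c i k = 0"
    using distinct by (auto simp: c_def)
  let ?P0 = "{f :: ('d, 'a) mfps. (monomial_subst a \<circ> mfps_twist (c j) \<circ> mfps_twist (c i)) f = 0}"
  let ?P1 = "{f :: ('d, 'a) mfps. (monomial_subst a \<circ> mfps_twist (c i)) f = 0}"
  let ?P2 = "{f :: ('d, 'a) mfps. monomial_subst a f = 0}"
  define Q where "Q = (\<lambda>n :: nat. if n = 0 then ?P0 else if n = 1 then ?P1 else ?P2)"
  have prime: "primeideal (Q n) mfps_ring" for n
    unfolding Q_def
    by (auto simp del: o_apply simp: comp_assoc intro!: primeideal_kernel
        ring_hom_trans[OF ring_hom_trans[OF mfps_twist_ring_hom mfps_twist_ring_hom]]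
        ring_hom_trans[OF mfps_twist_ring_hom] monomial_subst_ring_hom pos)
  have "mfps_var i ^ a j - mfps_var j ^ a i \<in> ?P2 - ?P1"
    by (simp add: monomial_subst_binomial pos
        monomial_subst_twist_binomial[of a "c i" i j, OF pos c(1,2)])
  moreover have "?P1 \<subseteq> ?P2"
    using monomial_subst_twist_eq_0D[OF pos] by auto
  ultimately have 1: "?P1 \<subset> ?P2"
    by blast
  \<comment> \<open>The binomial in x_j and x_k does not involve x_i, so freeing x_i leaves it in
    the kernel, and freeing x_j then removes it.\<close>
  have "mfps_twist (c i) (mfps_var j ^ a k - mfps_var k ^ a j) =
      (mfps_var j ^ a k - mfps_var k ^ a j :: ('d, 'a fps) mfps)"
    by (simp add: c mfps_twist_diff mfps_twist_power mfps_twist_var_eq)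
  then have "mfps_var j ^ a k - mfps_var k ^ a j \<in> ?P1 - ?P0"
    by (simp add: monomial_subst_binomial pos
        monomial_subst_twist_binomial[of a "c j" j k, OF pos c(3,4)])
  moreover have "?P0 \<subseteq> ?P1"
    using monomial_subst_twist_eq_0D[OF pos] by auto
  ultimately have 0: "?P0 \<subset> ?P1"
    by blast
  have "Q n \<subset> Q (Suc n)" if "n < 2" for n
    using that 0 1 less_2_cases[of n] by (auto simp: Q_def simp del: o_apply)
  moreover have "Q 2 = defining_ideal a"
    by (simp add: Q_def defining_ideal_def kernel_ring_of_type_algebra)
  ultimately show ?thesis
    using prime unfolding height_def by (intro SUP_upper) blast
qed

section \<open>Orders of power series\<close>

text \<open>Over a field this is the k-th power of the maximal ideal, described by coefficients so
  that products reduce to a degree count in the convolution.\<close>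

definition order_ge :: "nat \<Rightarrow> ('d::finite, 'a::zero) mfps set" where
  "order_ge k = {f. \<forall>e. sum e UNIV < k \<longrightarrow> mfps_nth f e = 0}"

lemma order_ge_add:
  fixes f g :: "('d::finite, 'a::comm_ring_1) mfps"
  shows "f \<in> order_ge k \<Longrightarrow> g \<in> order_ge k \<Longrightarrow> f + g \<in> order_ge k"
  by (simp add: order_ge_def plus_mfps.rep_eq)

lemma order_ge_mult:
  fixes f g :: "('d::finite, 'a::comm_ring_1) mfps"
  assumes "f \<in> order_ge k" "g \<in> order_ge l"
  shows "f * g \<in> order_ge (k + l)"
  unfolding order_ge_def
proof (intro CollectI allI impI)
  fix e :: "'d \<Rightarrow> nat"
  assume e: "sum e UNIV < k + l"
  have "mfps_nth f u * mfps_nth g (e - u) = 0" if "u \<le> e" for u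
  proof -
    have "sum u UNIV + sum (e - u) UNIV = sum e UNIV"
      using that by (simp add: le_fun_def flip: sum.distrib)
    with e have "sum u UNIV < k \<or> sum (e - u) UNIV < l"
      by linarith
    then show ?thesis
      using assms by (auto simp: order_ge_def)
  qed
  then show "mfps_nth (f * g) e = 0"
    by (simp add: times_mfps.rep_eq)
qed

text \<open>If e_i = 0, then a_i would be a combination of the other generators. Otherwise a_i e_i
  already uses up the whole sum, which forces e_i = 1 and leaves nothing for the rest.\<close>

lemma nonredundantD:
  fixes a :: "'d::finite \<Rightarrow> nat"
  assumes pos: "\<And>i. a i > 0" and nr: "nonredundant a" and e: "(\<Sum>j\<in>UNIV. a j * e j) = a i"
  shows "e = (\<lambda>j. if j = i then 1 else 0)"
proof -
  have split: "a i = a i * e i + (\<Sum>j\<in>UNIV - {i}. a j * e j)"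
    by (rule trans[OF e[symmetric] sum.remove]) auto
  have "e i \<noteq> 0"
  proof
    assume "e i = 0"
    with split have "a i = (\<Sum>j\<in>UNIV - {i}. e j * a j)"
      by (simp add: mult.commute)
    with nr show False
      unfolding nonredundant_def by blast
  qed
  moreover have "a i * e i \<le> a i * 1"
    using split by linarith
  then have "e i \<le> 1"
    using pos[of i] by (simp only: mult_le_cancel1)
  ultimately have 1: "e i = 1"
    by simp
  with split have "(\<Sum>j\<in>UNIV - {i}. a j * e j) = 0"
    by simp
  then have "e j = 0" if "j \<noteq> i" for j
    using that by (auto simp: pos[THEN less_not_refl2])
  with 1 show ?thesis
    by auto
qed

lemma defining_ideal_subset_order_ge_2:
  fixes a :: "'d::finite \<Rightarrow> nat"
  assumes pos: "\<And>i. a i > 0" and nr: "nonredundant a"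
  shows "(defining_ideal a :: ('d, 'a::field) mfps set) \<subseteq> order_ge 2"
proof
  fix f :: "('d, 'a) mfps"
  assume "f \<in> defining_ideal a"
  then have "monomial_subst a f $ n = 0" for n
    by (simp add: defining_ideal_def kernel_ring_of_type_algebra)
  then have 0: "(\<Sum>e | (\<Sum>i\<in>UNIV. a i * e i) = n. mfps_nth f e) = 0" for n
    by (simp add: monomial_subst_def)
  \<comment> \<open>A monomial that is alone in its weight cannot be cancelled. This applies to the
    constant monomial and, by nonredundancy, to each variable.\<close>
  have unique: "mfps_nth f u = 0"
    if "\<And>e. (\<Sum>i\<in>UNIV. a i * e i) = (\<Sum>i\<in>UNIV. a i * u i) \<Longrightarrow> e = u" for u
  proof -
    have "{e. (\<Sum>i\<in>UNIV. a i * e i) = (\<Sum>i\<in>UNIV. a i * u i)} = {u}"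
      using that by auto
    with 0[of "\<Sum>i\<in>UNIV. a i * u i"] show ?thesis
      by simp
  qed
  show "f \<in> order_ge 2"
    unfolding order_ge_def
  proof (intro CollectI allI impI)
    fix e :: "'d \<Rightarrow> nat"
    assume "sum e UNIV < 2"
    then consider "sum e UNIV = 0" | "sum e UNIV = 1"
      by linarith
    then show "mfps_nth f e = 0"
    proof cases
      case 1
      then have "e = (\<lambda>_. 0)"
        by auto
      then show ?thesis
        by (intro unique) (auto simp: fun_eq_iff pos[THEN less_not_refl2])
    next
      case 2
      then obtain i where i: "e i = 1" "\<And>j. j \<noteq> i \<Longrightarrow> e j = 0"
        by (subst (asm) sum_eq_1_iff) auto
      then have e: "e = (\<lambda>j. if j = i then 1 else 0)"
        by auto
      then have w: "(\<Sum>j\<in>UNIV. a j * e j) = a i"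
        by (simp add: if_distrib cong: if_cong)
      show ?thesis
      proof (rule unique)
        fix u
        assume "(\<Sum>j\<in>UNIV. a j * u j) = (\<Sum>j\<in>UNIV. a j * e j)"
        then have "(\<Sum>j\<in>UNIV. a j * u j) = a i"
          using w by (rule trans)
        then show "u = e"
          unfolding e by (rule nonredundantD[of a, OF pos nr])
      qed
    qed
  qed
qed

section \<open>The Hankel determinant\<close>

lemma (in cring) ideal_power_2:
  assumes "ideal I R"
  shows "ideal_power R I 2 = I \<cdot>\<^bsub>R\<^esub> I"
proof -
  interpret S: comm_monoid "ideals_set R"
    by (rule ideals_set_is_comm_monoid)
  have "I \<in> carrier (ideals_set R)"
    using assms by (simp add: ideals_set_def)
  then have "ideal_power R I 2 = I \<otimes>\<^bsub>ideals_set R\<^esub> I"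
    by (simp add: ideal_power_def numeral_2_eq_2)
  then show ?thesis
    by (simp add: ideals_set_def)
qed

text \<open>The expanded determinant of the 3 x 3 matrix with entries y_(i+j) for i, j = 0, 1,
  2.\<close>

definition hankel_det :: "(nat \<Rightarrow> 'r) \<Rightarrow> 'r::comm_ring_1" where
  "hankel_det y = y 0 * y 2 * y 4 + 2 * y 1 * y 2 * y 3 - y 2 ^ 3 - y 0 * y 3 ^ 2 - y 1 ^ 2 * y 4"

text \<open>Jacobi's identity for the upper left 2 x 2 minor of the adjugate, whose complementary
  entry is y_4. The sign is absorbed into a factor, so that the right side is a sum of products of
  two minors.\<close>

lemma hankel_det_adjugate_minor:
  fixes y :: "nat \<Rightarrow> 'r::comm_ring_1"
  shows "y 4 * hankel_det y = (y 2 * y 4 - y 3 * y 3) * (y 0 * y 4 - y 2 * y 2) +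
    (y 1 * y 4 - y 2 * y 3) * (y 2 * y 3 - y 1 * y 4)"
  unfolding hankel_det_def by (simp add: algebra_simps power2_eq_square power3_eq_cube)

lemma hankel_det_notin_order_ge_4:
  assumes inj: "inj_on s {..<5}"
  shows "hankel_det (\<lambda>k. mfps_var (s k)) \<notin>
    (order_ge 4 :: ('d::finite, 'a::comm_ring_1) mfps set)" (is "?\<Delta> \<notin> _")
proof
  assume order: "?\<Delta> \<in> order_ge 4"
  text \<open>The form \<open>\<Delta>\<close> vanishes when all variables become equal, so \<open>y\<^sub>2\<close> gets another weight.\<close>
  define c where "c = (\<lambda>i. if i = s 2 then 1 else 0 :: nat)"
  define h :: "('d, 'a) mfps \<Rightarrow> 'a fps fps"
    where "h f = monomial_subst (\<lambda>_. 1) (mfps_twist c f)" for f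
  define v :: "'a fps fps" where "v = fps_const fps_X"
  have h_add: "h (f + g) = h f + h g" and h_diff: "h (f - g) = h f - h g"
    and h_mult: "h (f * g) = h f * h g" for f g
    by (simp_all add: h_def mfps_twist_add mfps_twist_diff mfps_twist_mult monomial_subst_add
        monomial_subst_diff monomial_subst_mult)
  have h_power: "h (f ^ n) = h f ^ n" for f n
    by (simp add: h_def mfps_twist_power monomial_subst_power)
  have h_2: "h 2 = 2"
    using h_add[of 1 1] by (simp add: h_def mfps_twist_one monomial_subst_one)
  have h_y: "h (mfps_var (s k)) = (if k = 2 then v else 1) * fps_X" if "k < 5" for k
    using inj that by (auto simp: h_def monomial_subst_twist_var c_def v_def inj_on_eq_iff)
  have "h ?\<Delta> = (3 * v - v ^ 3 - 2) * fps_X ^ 3"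
    by (simp add: hankel_det_def h_add h_diff h_mult h_power h_2 h_y algebra_simps
        power2_eq_square power3_eq_cube)
  \<comment> \<open>The coefficient at the third power of the inner variable is -1, which is nonzero
    in every characteristic, unlike 3 and -2.\<close>
  also have "\<dots> = fps_const (3 * fps_X - fps_X ^ 3 - 2) * fps_X ^ 3"
    by (simp add: v_def flip: fps_const_sub fps_const_mult fps_const_power numeral_fps_const)
  finally have "h ?\<Delta> $ 3 $ 3 = -1"
    by (simp add: fps_X_power_iff fps_numeral_nth)
  \<comment> \<open>All weights are 1 here, so the outer coefficient at 3 only collects monomials of
    total degree 3.\<close>
  moreover have "h f $ 3 = 0" if "f \<in> order_ge 4" for f
    using that by (auto simp: h_def monomial_subst_def mfps_twist.rep_eq order_ge_def
        intro!: sum.neutral)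
  ultimately show False
    using order by auto
qed

lemma symbolic_square_defining_ideal_neq:
  fixes a :: "'d::finite \<Rightarrow> nat"
  assumes pos: "\<And>i. a i > 0" and nr: "nonredundant a"
    and inj: "inj_on s {..<5}" and arith: "\<And>k. k < 5 \<Longrightarrow> a (s k) = b + k * \<delta>"
  shows "ideal_power mfps_ring (defining_ideal a :: ('d, 'a::field) mfps set) 2 \<noteq>
    symbolic_power mfps_ring (defining_ideal a) 2"
proof -
  let ?R = "mfps_ring :: ('d, 'a) mfps ring"
  let ?P = "defining_ideal a :: ('d, 'a) mfps set"
  define y :: "nat \<Rightarrow> ('d, 'a) mfps" where "y k = mfps_var (s k)" for k
  interpret R: cring ?R
    by (rule cring_from_type_algebra)
  have P: "?P = {f. monomial_subst a f = 0}"
    by (simp add: defining_ideal_def kernel_ring_of_type_algebra)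
  have "primeideal ?P ?R"
    unfolding P by (intro primeideal_kernel monomial_subst_ring_hom pos)
  then have square: "ideal_power ?R ?P 2 = ?P \<cdot>\<^bsub>?R\<^esub> ?P"
    by (intro R.ideal_power_2 primeideal.axioms)
  \<comment> \<open>Along an arithmetic progression, equal index sums give equal powers of
    t.\<close>
  have minor: "y i * y j - y k * y l \<in> ?P" if "i + j = k + l" "i < 5" "j < 5" "k < 5" "l < 5"
    for i j k l
  proof -
    have "a (s i) + a (s j) = a (s k) + a (s l)"
      using that by (simp add: arith flip: add_mult_distrib)
    then show ?thesis
      by (simp add: P y_def monomial_subst_diff monomial_subst_mult monomial_subst_var pos
          flip: power_add)
  qed
  have "y 4 * hankel_det y \<in> ?P \<cdot>\<^bsub>?R\<^esub> ?P"
    unfolding hankel_det_adjugate_minor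
    by (rule ideal_prod.sum[where R = ?R, simplified]; rule ideal_prod.prod[where R = ?R, simplified])
      (auto intro!: minor)
  \<comment> \<open>So \<open>y 4\<close>, whose image is a power of t, can serve as the denominator
    in the symbolic square.\<close>
  moreover have "y 4 \<notin> ?P"
    by (simp add: P y_def monomial_subst_var pos)
  ultimately have "hankel_det y \<in> symbolic_power ?R ?P 2"
    unfolding symbolic_power_def square by auto
  moreover have "f \<in> order_ge 4" if "f \<in> ?P \<cdot>\<^bsub>?R\<^esub> ?P" for f
    using that
  proof induction
    case (prod f g)
    then show ?case
      using defining_ideal_subset_order_ge_2[OF pos nr] order_ge_mult[of f 2 g 2] by auto
  qed (simp add: order_ge_add)
  moreover have "hankel_det y \<notin> order_ge 4"
    using hankel_det_notin_order_ge_4[OF inj] by (simp add: y_def[abs_def])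
  ultimately show ?thesis
    unfolding square by blast
qed

theorem corollary2p6:
  fixes a :: "'d::{finite,linorder} \<Rightarrow> nat"
    and R :: "('d, 'a::field) mfps ring"
    and P :: "('d, 'a) mfps set"
  assumes pos: "\<And>i. a i > 0"
    and increasing: "strict_mono a"
    and gcd1: "Gcd (range a) = 1"
    and nonredundant: "nonredundant a"
    and R: "R = mfps_ring"
    and P: "P = defining_ideal a"
    and arith: "has_arithmetic_subsequence a 5"
  shows "((\<forall>n>0. enat n \<le> height R P \<longrightarrow> ideal_power R P n = symbolic_power R P n) \<longrightarrow>
            (\<forall>n>0. ideal_power R P n = symbolic_power R P n)) \<and>
         (ideal_power R P 2 = symbolic_power R P 2 \<longrightarrow> gorenstein_local_ring (R Quot P))"
proof -
  obtain s b \<delta> where s: "strict_mono_on {..<5} s" and a: "\<And>k. k < 5 \<Longrightarrow> a (s k) = b + k * \<delta>"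
    using arith unfolding has_arithmetic_subsequence_def by blast
  from s have inj: "inj_on s {..<5}"
    by (rule strict_mono_on_imp_inj_on)
  have "ideal_power R P 2 \<noteq> symbolic_power R P 2"
    unfolding R P using symbolic_square_defining_ideal_neq[OF pos nonredundant inj a] .
  moreover have "distinct [s 0, s 1, s 2]"
    using inj by (simp add: inj_on_eq_iff)
  then have "enat 2 \<le> height R P"
    unfolding R P by (rule height_defining_ideal_ge_2[OF pos])
  \<comment> \<open>The value n = 2 is within the range of the first hypothesis, so both
    implications have a false premise.\<close>
  ultimately show ?thesis
    by fastforce
qed

end
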